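(* Let $\mathcal{P}_1,\mathcal{P}_2\subset\mathbb{R}^n$ be full-dimensional rational anti-blocking polytopes and assume $\mathcal{P}_1$ is dual integral. Then for all $a,b\in\mathbb{Z}_{>0}$, \[\big|(a\mathcal{P}_1-b\mathcal{P}_2)\cap\mathbb{Z}^n\big|=\sum_{J\subseteq[n]}\big|\operatorname{relint}((a+1)\mathcal{P}_1|_J)\cap\mathbb{Z}^n\big|\cdot\big|b\mathcal{P}_2|_{J^c}\cap\mathbb{Z}^n\big|.\]
   Context: A polytope $\mathcal{P}\subseteq\mathbb{R}^n_{\ge0}$ is anti-blocking if $q\in\mathcal{P}$, $0\le p\le q$ imply $p\in\mathcal{P}$. Its associated anti-blocking polytope is $A(\mathcal{P})=\{d\in\mathbb{R}^n_{\ge0}:\langle d,x\rangle\le1\ \forall x\in\mathcal{P}\}$; $\mathcal{P}$ is dual integral if all vertices of $A(\mathcal{P})$ lie in $\mathbb{Z}^n$. For $J\subseteq[n]$, $\mathcal{P}|_J=\{x\in\mathcal{P}:x_j=0\text{ for }j\notin J\}$ (a $|J|$-dimensional face), $J^c=[n]\setminus J$, and $\operatorname{relint}$ denotes relative interior (for $J=\emptyset$, $\operatorname{relint}\{0\}=\{0\}$). *)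

theory Defs
  imports "HOL-Analysis.Analysis"
begin

definition integer_points :: "(real ^ 'n) set" where
  "integer_points = {x. \<forall>i. x $ i \<in> \<int>}"

definition rational_points :: "(real ^ 'n) set" where
  "rational_points = {x. \<forall>i. x $ i \<in> \<rat>}"

definition rational_polytope :: "(real ^ 'n) set \<Rightarrow> bool" where
  "rational_polytope P \<longleftrightarrow> polytope P \<and> {v. v extreme_point_of P} \<subseteq> rational_points"

definition full_dimensional :: "(real ^ 'n) set \<Rightarrow> bool" where
  "full_dimensional P \<longleftrightarrow> aff_dim P = int CARD('n)"

text \<open>The order on \<^typ>\<open>real ^ 'n\<close> is the componentwise one.\<close>

definition anti_blocking :: "(real ^ 'n) set \<Rightarrow> bool" where
  "anti_blocking P \<longleftrightarrow>
     P \<subseteq> {x. 0 \<le> x} \<and> (\<forall>q\<in>P. \<forall>p. 0 \<le> p \<and> p \<le> q \<longrightarrow> p \<in> P)"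

definition associated_anti_blocking :: "(real ^ 'n) set \<Rightarrow> (real ^ 'n) set" where
  "associated_anti_blocking P = {d. 0 \<le> d \<and> (\<forall>x\<in>P. d \<bullet> x \<le> 1)}"

definition dual_integral :: "(real ^ 'n) set \<Rightarrow> bool" where
  "dual_integral P \<longleftrightarrow>
     {v. v extreme_point_of associated_anti_blocking P} \<subseteq> integer_points"

definition coord_face :: "(real ^ 'n) set \<Rightarrow> 'n set \<Rightarrow> (real ^ 'n) set" where
  "coord_face P J = {x \<in> P. \<forall>j. j \<notin> J \<longrightarrow> x $ j = 0}"

definition dilate :: "nat \<Rightarrow> (real ^ 'n) set \<Rightarrow> (real ^ 'n) set" where
  "dilate k P = (\<lambda>x. real k *\<^sub>R x) ` P"

text \<open>Pointwise difference \<open>P + (-Q)\<close>, not the set difference written \<open>P - Q\<close> in HOL.\<close>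

definition minkowski_diff :: "(real ^ 'n) set \<Rightarrow> (real ^ 'n) set \<Rightarrow> (real ^ 'n) set" where
  "minkowski_diff P Q = {x - y | x y. x \<in> P \<and> y \<in> Q}"

end

theory Submission
  imports Defs
begin

text \<open>
  By anti-blocking, \<open>z\<close> lies in \<open>a P1 - b P2\<close> iff its positive part lies in \<open>a P1\<close> and its
  negative part in \<open>b P2\<close>. Sort the integer points \<open>z\<close> by the set \<open>J\<close> of their positive
  coordinates. It remains to see that an integer point lies in the relative interior of
  \<open>(a + 1) P1|J\<close> iff it lies in \<open>a P1\<close> and has support exactly \<open>J\<close>. A relative interior
  point \<open>x\<close> satisfies \<open>d \<bullet> x < a + 1\<close> for every vertex \<open>d\<close> of the associated anti-blocking
  polytope; as \<open>d\<close> is integral, \<open>d \<bullet> x \<le> a\<close>, and anti-blocking duality puts \<open>x\<close> into \<open>a P1\<close>.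
\<close>

section \<open>Dilations and coordinate faces\<close>

lemma mem_dilate_iff:
  assumes "k > 0"
  shows "x \<in> dilate k P \<longleftrightarrow> (1 / real k) *\<^sub>R x \<in> P"
proof
  assume "(1 / real k) *\<^sub>R x \<in> P"
  moreover have "x = real k *\<^sub>R ((1 / real k) *\<^sub>R x)" using assms by simp
  ultimately show "x \<in> dilate k P" unfolding dilate_def by blast
qed (use assms in \<open>auto simp: dilate_def\<close>)

lemma anti_blocking_dilate:
  assumes "anti_blocking P" "k > 0"
  shows "anti_blocking (dilate k P)"
  unfolding anti_blocking_def
proof (intro conjI ballI allI impI subsetI)
  fix x assume "x \<in> dilate k P"
  then show "x \<in> {x. 0 \<le> x}"
    using assms by (auto simp: anti_blocking_def dilate_def less_eq_vec_def)
next
  fix q p assume "q \<in> dilate k P" and pq: "0 \<le> p \<and> p \<le> q"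
  then have "(1 / real k) *\<^sub>R q \<in> P" using assms by (simp add: mem_dilate_iff)
  moreover have "0 \<le> (1 / real k) *\<^sub>R p \<and> (1 / real k) *\<^sub>R p \<le> (1 / real k) *\<^sub>R q"
    using pq by (auto simp: less_eq_vec_def divide_right_mono)
  ultimately show "p \<in> dilate k P"
    using assms unfolding anti_blocking_def by (metis mem_dilate_iff)
qed

lemma coord_face_dilate:
  assumes "k > 0"
  shows "dilate k (coord_face P J) = coord_face (dilate k P) J"
  using assms by (auto simp: set_eq_iff mem_dilate_iff coord_face_def)

lemma convex_dilate: "convex P \<Longrightarrow> convex (dilate k P)"
  unfolding dilate_def by (rule convex_scaling)

lemma convex_coord_face:
  assumes "convex P" shows "convex (coord_face P J)"
proof -
  have "coord_face P J = P \<inter> (\<Inter>j\<in>-J. {x. axis j 1 \<bullet> x = 0})"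
    by (auto simp: coord_face_def inner_axis')
  moreover have "convex (P \<inter> (\<Inter>j\<in>-J. {x. axis j 1 \<bullet> x = 0}))"
    by (intro convex_Int assms convex_INT convex_hyperplane)
  ultimately show ?thesis by simp
qed

lemma bounded_dilate: "bounded P \<Longrightarrow> bounded (dilate k P)"
  unfolding dilate_def by (rule bounded_scaling)

text \<open>A norm bound \<open>B\<close> confines every coordinate to finitely many integers. The
  counting argument needs this finiteness for the cardinality of a disjoint union.\<close>

lemma finite_bounded_Int_integer_points:
  fixes S :: "(real ^ 'n) set"
  assumes "bounded S"
  shows "finite (S \<inter> integer_points)"
proof -
  obtain B where B: "\<And>x. x \<in> S \<Longrightarrow> norm x \<le> B" using assms bounded_iff by metis
  let ?F = "PiE (UNIV :: 'n set) (\<lambda>_. {- \<lceil>B\<rceil>..\<lceil>B\<rceil>})"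
  have "S \<inter> integer_points \<subseteq> (\<lambda>f. \<chi> i. real_of_int (f i)) ` ?F"
  proof
    fix x assume x: "x \<in> S \<inter> integer_points"
    have e: "real_of_int \<lfloor>x $ i\<rfloor> = x $ i" for i
      using x by (auto simp: integer_points_def elim: Ints_cases)
    have "\<lfloor>x $ i\<rfloor> \<in> {- \<lceil>B\<rceil>..\<lceil>B\<rceil>}" for i
    proof -
      have "\<bar>x $ i\<bar> \<le> B" using component_le_norm_cart[of x i] B[of x] x by auto
      then have "\<bar>real_of_int \<lfloor>x $ i\<rfloor>\<bar> \<le> real_of_int \<lceil>B\<rceil>" using e[of i] by linarith
      then show ?thesis by auto
    qed
    moreover have "x = (\<chi> i. real_of_int \<lfloor>x $ i\<rfloor>)" by (simp add: e)
    ultimately show "x \<in> (\<lambda>f. \<chi> i. real_of_int (f i)) ` ?F"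
      by (intro image_eqI[of _ _ "\<lambda>i. \<lfloor>x $ i\<rfloor>"]) auto
  qed
  moreover have "finite ?F" by (intro finite_PiE) auto
  ultimately show ?thesis using finite_surj by blast
qed

section \<open>Anti-blocking duality\<close>

text \<open>\<open>P\<close> contains a ball; moving its centre back by the radius along any axis
  stays in \<open>P\<close>, hence in the nonnegative orthant. The point serves to bound the
  associated polytope and to produce points of each face that are positive on
  \<open>J\<close>.\<close>

lemma full_dimensional_obtains_positive_point:
  fixes P :: "(real ^ 'n) set"
  assumes "convex P" "full_dimensional P" "anti_blocking P"
  obtains p where "p \<in> P" "\<And>i. p $ i > 0"
proof -
  have "affine hull P = UNIV"
    using assms(2) by (simp add: full_dimensional_def flip: aff_dim_eq_full)
  then have "interior P \<noteq> {}"
    using assms by (metis rel_interior_interior rel_interior_eq_empty affine_hull_empty UNIV_not_empty)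
  then obtain p e where e: "e > 0" "cball p e \<subseteq> P" by (auto simp: mem_interior_cball)
  have "p $ i > 0" for i
  proof -
    have "p - e *\<^sub>R axis i 1 \<in> P" using e by (auto simp: dist_norm)
    then have "0 \<le> p - e *\<^sub>R axis i 1" using assms(3) unfolding anti_blocking_def by blast
    then have "0 \<le> (p - e *\<^sub>R axis i 1) $ i" unfolding less_eq_vec_def by (metis zero_index)
    then show ?thesis using e by simp
  qed
  moreover have "p \<in> P" using e by auto
  ultimately show thesis using that by blast
qed

text \<open>As an intersection of closed half-spaces the set is visibly convex and closed.\<close>

lemma associated_anti_blocking_eq_Inter:
  "associated_anti_blocking P =
     (\<Inter>i. {d. axis i 1 \<bullet> d \<ge> 0}) \<inter> (\<Inter>x\<in>P. {d. x \<bullet> d \<le> 1})"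
  by (auto simp: associated_anti_blocking_def less_eq_vec_def inner_axis inner_commute)

lemma convex_associated_anti_blocking: "convex (associated_anti_blocking P)"
  unfolding associated_anti_blocking_eq_Inter
  by (intro convex_Int convex_INT convex_halfspace_ge convex_halfspace_le)

text \<open>All terms of \<open>d \<bullet> p\<close> are nonnegative, so each is at most 1, which
  puts \<open>d\<close> into a box. Compactness is what lets the extreme points generate the
  set.\<close>

lemma compact_associated_anti_blocking:
  assumes "p \<in> P" "\<And>i. p $ i > 0"
  shows "compact (associated_anti_blocking P)"
proof -
  have "closed (associated_anti_blocking P)"
    unfolding associated_anti_blocking_eq_Inter
    by (intro closed_Int closed_INT ballI closed_halfspace_ge closed_halfspace_le)
  moreover have "associated_anti_blocking P \<subseteq> cbox 0 (\<chi> i. 1 / p $ i)"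
  proof
    fix d assume d: "d \<in> associated_anti_blocking P"
    then have d0: "0 \<le> d $ i" for i by (auto simp: associated_anti_blocking_def less_eq_vec_def)
    have "d $ i * p $ i \<le> 1" for i
    proof -
      have "d $ i * p $ i \<le> (\<Sum>j\<in>UNIV. d $ j * p $ j)"
        using d0 assms(2) by (intro member_le_sum) (auto simp: less_imp_le)
      also have "\<dots> \<le> 1" using d assms by (auto simp: associated_anti_blocking_def inner_vec_def)
      finally show ?thesis .
    qed
    then show "d \<in> cbox 0 (\<chi> i. 1 / p $ i)"
      using d0 assms(2) by (auto simp: mem_box_cart field_simps)
  qed
  ultimately show ?thesis
    by (metis bounded_cbox bounded_subset compact_eq_bounded_closed)
qed

text \<open>A one-sided bipolar theorem: separate \<open>x\<close> from \<open>P\<close> by a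
  hyperplane, then replace its normal by a nonnegative one, which anti-blocking permits.\<close>

lemma anti_blocking_duality:
  fixes P :: "(real ^ 'n) set"
  assumes "convex P" "closed P" "anti_blocking P" "0 \<in> P" "0 \<le> x"
    and x: "\<And>d. d \<in> associated_anti_blocking P \<Longrightarrow> d \<bullet> x \<le> 1"
  shows "x \<in> P"
proof (rule ccontr)
  assume "x \<notin> P"
  then obtain c \<beta> where c: "c \<bullet> x < \<beta>" "\<And>y. y \<in> P \<Longrightarrow> c \<bullet> y > \<beta>"
    using separating_hyperplane_closed_point[of P x] assms by blast
  have \<beta>: "\<beta> < 0" using c(2)[OF assms(4)] by simp
  define d :: "real ^ 'n" where "d = (\<chi> i. max 0 (- c $ i))"
  have "d \<bullet> y \<le> - \<beta>" if y: "y \<in> P" for y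
  proof -
    \<comment> \<open>Erasing the coordinates where \<open>-c\<close> is not positive keeps the
      point in \<open>P\<close>, and on the remaining ones \<open>d\<close> agrees with
      \<open>-c\<close>.\<close>
    define y' :: "real ^ 'n" where "y' = (\<chi> i. if c $ i < 0 then y $ i else 0)"
    have "0 \<le> y' \<and> y' \<le> y"
      using y assms(3) by (auto simp: y'_def less_eq_vec_def anti_blocking_def)
    then have "y' \<in> P" using y assms(3) by (auto simp: anti_blocking_def)
    moreover have "d \<bullet> y = - (c \<bullet> y')"
      unfolding inner_vec_def sum_negf[symmetric]
      by (intro sum.cong) (auto simp: d_def y'_def max_def)
    ultimately show ?thesis using c(2)[of y'] by simp
  qed
  then have "(1 / - \<beta>) *\<^sub>R d \<in> associated_anti_blocking P"
    using \<beta> by (auto simp: associated_anti_blocking_def less_eq_vec_def d_def field_simps)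
  from x[OF this] have "d \<bullet> x \<le> - \<beta>" using \<beta> by (simp add: field_simps)
  moreover have "- (c \<bullet> x) \<le> d \<bullet> x"
    unfolding inner_vec_def sum_negf[symmetric]
  proof (intro sum_mono)
    fix i have "- c $ i * x $ i \<le> d $ i * x $ i"
      using assms(5) by (intro mult_right_mono) (auto simp: d_def less_eq_vec_def)
    then show "- (c $ i \<bullet> x $ i) \<le> d $ i \<bullet> x $ i" by simp
  qed
  ultimately show False using c(1) by simp
qed

text \<open>The factor \<open>e > 1\<close> expresses that \<open>x\<close> can be pushed outwards
  inside the \<open>(a + 1)\<close>-fold dilate. This makes \<open>d \<bullet> x < a + 1\<close>
  strict for each vertex \<open>d\<close>, and integrality rounds it down to
  \<open>a\<close>.\<close>

lemma anti_blocking_dual_integral_mem_dilate: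
  fixes P :: "(real ^ 'n) set"
  assumes P: "convex P" "closed P" "anti_blocking P" "0 \<in> P" "dual_integral P"
    and p: "p \<in> P" "\<And>i. p $ i > 0"
    and x: "x \<in> integer_points" "e > 1" "e *\<^sub>R x \<in> dilate (a + 1) P" and "a > 0"
  shows "x \<in> dilate a P"
proof -
  let ?A = "associated_anti_blocking P"
  have ex: "(e / real (a + 1)) *\<^sub>R x \<in> P"
    using x(3) by (simp add: mem_dilate_iff)
  have "d \<bullet> x \<le> a" if "d extreme_point_of ?A" for d
  proof -
    have "d \<in> ?A" using that by (simp add: extreme_point_of_def)
    then have "d \<bullet> ((e / real (a + 1)) *\<^sub>R x) \<le> 1"
      using ex unfolding associated_anti_blocking_def by blast
    then have "e * (d \<bullet> x) \<le> real (a + 1)" by (simp add: field_simps)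
    moreover have "real (a + 1) < e * real (a + 1)" using x(2) by simp
    ultimately have "d \<bullet> x < real (a + 1)"
      using x(2) mult_less_cancel_left_pos[of e "d \<bullet> x" "real (a + 1)"] by linarith
    moreover have "d \<bullet> x \<in> \<int>"
      using that P(5) x(1)
      by (auto simp: inner_vec_def dual_integral_def integer_points_def intro!: Ints_sum Ints_mult)
    ultimately obtain z where "d \<bullet> x = of_int z" "real_of_int z < real_of_int (int (a + 1))"
      by (auto elim: Ints_cases)
    then show ?thesis unfolding of_int_less_iff by simp
  qed
  \<comment> \<open>The bound is linear in \<open>d\<close>, so it passes from the vertices to all
    of \<open>?A\<close> by Krein-Milman.\<close>
  then have "convex hull {d. d extreme_point_of ?A} \<subseteq> {d. x \<bullet> d \<le> a}"
    by (intro hull_minimal convex_halfspace_le) (auto simp: inner_commute)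
  then have "?A \<subseteq> {d. x \<bullet> d \<le> a}"
    using Krein_Milman_Minkowski[OF compact_associated_anti_blocking[OF p]
        convex_associated_anti_blocking] by simp
  then have "(1 / real a) *\<^sub>R x \<in> P"
  proof (intro anti_blocking_duality[OF P(1-4)])
    have "0 \<le> (e / real (a + 1)) *\<^sub>R x" using ex P(3) by (auto simp: anti_blocking_def)
    then have "0 \<le> e / real (a + 1) * x $ i" for i by (simp add: less_eq_vec_def)
    moreover have "e / real (a + 1) > 0" using x(2) by simp
    ultimately have "0 \<le> x $ i" for i by (meson zero_le_mult_iff not_le)
    then show "0 \<le> (1 / real a) *\<^sub>R x" by (simp add: less_eq_vec_def)
  qed (use \<open>a > 0\<close> in \<open>auto simp: inner_commute\<close>)
  then show ?thesis using \<open>a > 0\<close> by (simp add: mem_dilate_iff)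
qed

section \<open>Lattice points in relative interiors of faces\<close>

text \<open>Both directions use that \<open>x\<close> is relatively interior iff every segment from
  a point \<open>y\<close> of the face to \<open>x\<close> can be prolonged beyond \<open>x\<close>.
  For the converse, nonzero coordinates of an integer point of \<open>dilate a P\<close> are at
  least 1, which leaves room for prolonging.\<close>

lemma rel_interior_dilate_coord_face_Int_integer_points:
  fixes P :: "(real ^ 'n) set"
  assumes P: "polytope P" "full_dimensional P" "anti_blocking P" "dual_integral P"
    and a: "a > 0"
  shows "rel_interior (dilate (a + 1) (coord_face P J)) \<inter> integer_points =
    {x \<in> dilate a P \<inter> integer_points. {i. x $ i \<noteq> 0} = J}"
proof -
  define S where "S = coord_face (dilate (a + 1) P) J"
  note cP = polytope_imp_convex[OF P(1)]
  obtain p where p: "p \<in> P" "\<And>i. p $ i > 0"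
    using full_dimensional_obtains_positive_point[OF cP P(2,3)] by blast
  have "0 \<in> P" using p P(3) by (force simp: anti_blocking_def less_eq_vec_def less_imp_le)
  have ab: "anti_blocking (dilate (a + 1) P)" using P(3) by (simp add: anti_blocking_dilate)
  have "0 \<in> S"
    using \<open>0 \<in> P\<close> by (simp add: S_def coord_face_def mem_dilate_iff)
  have rel: "x \<in> rel_interior S \<longleftrightarrow> (\<forall>y\<in>S. \<exists>e>1. (1 - e) *\<^sub>R y + e *\<^sub>R x \<in> S)" for x
    using \<open>0 \<in> S\<close> cP unfolding S_def
    by (intro convex_rel_interior_iff convex_coord_face convex_dilate) auto
  have "x \<in> rel_interior S \<longleftrightarrow> x \<in> dilate a P \<and> {i. x $ i \<noteq> 0} = J"
    if xi: "x \<in> integer_points" for x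
  proof
    assume x: "x \<in> rel_interior S"
    have xS: "x \<in> S" using x rel_interior_subset by blast
    \<comment> \<open>Prolong the segment from the origin.\<close>
    obtain e where "e > 1" "e *\<^sub>R x \<in> S"
      using x \<open>0 \<in> S\<close> unfolding rel by fastforce
    then have "x \<in> dilate a P"
      using P(1) \<open>0 \<in> P\<close>
      by (intro anti_blocking_dual_integral_mem_dilate[OF cP _ P(3) _ P(4) p xi])
        (auto simp: S_def coord_face_def polytope_imp_closed a)
    moreover have "x $ j \<noteq> 0" if j: "j \<in> J" for j
    proof
      assume "x $ j = 0"
      \<comment> \<open>\<open>q\<close> is a point of the face that is positive on
        \<open>J\<close>. If \<open>x $ j = 0\<close>, prolonging the segment from \<open>q\<close>
        beyond \<open>x\<close> makes coordinate \<open>j\<close> negative.\<close>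
      define q :: "real ^ 'n" where "q = (\<chi> i. if i \<in> J then p $ i else 0)"
      have "(1 / real (a + 1)) *\<^sub>R q \<le> p"
      proof -
        have "p $ i / real (a + 1) \<le> p $ i" for i
          using p(2)[of i] by (simp add: field_simps)
        then show ?thesis using p(2) by (auto simp: less_eq_vec_def q_def less_imp_le)
      qed
      moreover have "0 \<le> (1 / real (a + 1)) *\<^sub>R q"
        using p(2) by (auto simp: less_eq_vec_def q_def less_imp_le)
      ultimately have "(1 / real (a + 1)) *\<^sub>R q \<in> P"
        using P(3) p(1) unfolding anti_blocking_def by blast
      then have "q \<in> S"
        using mem_dilate_iff[of "a + 1" q P] by (simp add: S_def coord_face_def q_def)
      then obtain e where e: "e > 1" "(1 - e) *\<^sub>R q + e *\<^sub>R x \<in> S" using x rel by blast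
      then have "((1 - e) *\<^sub>R q + e *\<^sub>R x) $ j \<ge> 0"
        using ab by (auto simp: S_def coord_face_def anti_blocking_def less_eq_vec_def)
      then have "(1 - e) * p $ j \<ge> 0" using \<open>x $ j = 0\<close> j by (simp add: q_def)
      then show False using e(1) p(2)[of j] by (simp add: zero_le_mult_iff)
    qed
    moreover have "x $ j = 0" if "j \<notin> J" for j
      using xS that by (auto simp: S_def coord_face_def)
    ultimately show "x \<in> dilate a P \<and> {i. x $ i \<noteq> 0} = J" by auto
  next
    assume x: "x \<in> dilate a P \<and> {i. x $ i \<noteq> 0} = J"
    have x0: "0 \<le> x $ i" for i
      using x anti_blocking_dilate[OF P(3) a] by (auto simp: anti_blocking_def less_eq_vec_def)
    have x1: "1 \<le> x $ i" if "i \<in> J" for i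
    proof -
      obtain k where "x $ i = real_of_int k" using xi by (auto simp: integer_points_def elim: Ints_cases)
      moreover have "x $ i \<noteq> 0" using x that by auto
      ultimately show ?thesis using x0[of i] by auto
    qed
    have "\<exists>e>1. (1 - e) *\<^sub>R y + e *\<^sub>R x \<in> S" if y: "y \<in> S" for y
    proof -
      have y0: "0 \<le> y $ i" for i
        using y ab by (auto simp: S_def coord_face_def anti_blocking_def less_eq_vec_def)
      \<comment> \<open>The first bound gives \<open>(1 + \<delta>) * a \<le> a + 1\<close>, so the
        prolonged point stays in the larger dilate. The second gives
        \<open>\<delta> * y $ i \<le> 1 \<le> x $ i\<close> on \<open>J\<close>, so it stays
        nonnegative; the summand 1 in the denominator covers \<open>y = 0\<close>.\<close>
      define \<delta> where "\<delta> = min (1 / real a) (1 / (1 + norm y))"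
      have \<delta>: "\<delta> > 0" "\<delta> \<le> 1 / real a" "\<delta> * (1 + norm y) \<le> 1"
        using a by (auto simp: \<delta>_def min_def field_simps add_pos_nonneg)
      define z where "z = (1 - (1 + \<delta>)) *\<^sub>R y + (1 + \<delta>) *\<^sub>R x"
      have z: "z $ i = (1 + \<delta>) * x $ i - \<delta> * y $ i" for i by (simp add: z_def)
      have out: "z $ i = 0" if "i \<notin> J" for i
        using that x y by (auto simp: z S_def coord_face_def)
      have "0 \<le> z $ i" for i
      proof (cases "i \<in> J")
        case True
        have "\<delta> * y $ i \<le> \<delta> * (1 + norm y)"
          using component_le_norm_cart[of y i] \<delta>(1) by (intro mult_left_mono) auto
        also have "\<dots> \<le> x $ i" using \<delta>(3) x1[OF True] by simp
        also have "\<dots> \<le> (1 + \<delta>) * x $ i" using x0[of i] \<delta>(1) by (simp add: algebra_simps)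
        finally show ?thesis by (simp add: z)
      qed (simp add: out)
      moreover have "(1 / real (a + 1)) * z $ i \<le> (1 / real a) * x $ i" for i
      proof -
        have "z $ i \<le> (1 + \<delta>) * x $ i" using y0[of i] \<delta>(1) by (simp add: z)
        also have "\<dots> \<le> (1 + 1 / real a) * x $ i" using \<delta>(2) x0 by (intro mult_right_mono) auto
        also have "\<dots> = real (a + 1) * ((1 / real a) * x $ i)" using a by (simp add: field_simps)
        finally show ?thesis by (simp add: field_simps)
      qed
      ultimately have "0 \<le> (1 / real (a + 1)) *\<^sub>R z" "(1 / real (a + 1)) *\<^sub>R z \<le> (1 / real a) *\<^sub>R x"
        by (simp_all add: less_eq_vec_def)
      moreover have "(1 / real a) *\<^sub>R x \<in> P" using x a by (simp add: mem_dilate_iff)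
      ultimately have "(1 / real (a + 1)) *\<^sub>R z \<in> P" using P(3) unfolding anti_blocking_def by blast
      then have "z \<in> S" using out mem_dilate_iff[of "a + 1" z P] by (simp add: S_def coord_face_def)
      then show ?thesis using \<delta>(1) unfolding z_def by (intro exI[of _ "1 + \<delta>"]) auto
    qed
    then show "x \<in> rel_interior S" by (simp add: rel)
  qed
  moreover have "dilate (a + 1) (coord_face P J) = S" by (simp add: S_def coord_face_dilate)
  ultimately show ?thesis by auto
qed

section \<open>Counting by positive and negative parts\<close>

text \<open>Each \<open>z\<close> in the difference splits into its positive and negative parts. The
  first factor fixes the support to be exactly \<open>J\<close>, while the second only asks for
  vanishing on \<open>J\<close>; so \<open>J\<close> is the set of positive coordinates of
  \<open>z\<close> and no point is counted twice.\<close>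

lemma card_minkowski_diff_anti_blocking:
  fixes P Q :: "(real ^ 'n) set"
  assumes P: "anti_blocking P" "bounded P" and Q: "anti_blocking Q" "bounded Q"
  shows "card (minkowski_diff P Q \<inter> integer_points) =
    (\<Sum>J\<in>UNIV. card {x \<in> P \<inter> integer_points. {i. x $ i \<noteq> 0} = J} *
                 card (coord_face Q (- J) \<inter> integer_points))"
proof -
  define A where "A J = {x \<in> P \<inter> integer_points. {i. x $ i \<noteq> 0} = J}" for J
  define B where "B J = coord_face Q (- J) \<inter> integer_points" for J
  let ?D = "SIGMA J:UNIV. A J \<times> B J"
  let ?f = "\<lambda>(J :: 'n set, x, y). x - y :: real ^ 'n"
  \<comment> \<open>The whole triple is recovered from the difference, which yields
    injectivity.\<close>
  have pos: "J = {i. (x - y) $ i > 0} \<and> x = (\<chi> i. max 0 ((x - y) $ i)) \<and>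
      y = (\<chi> i. max 0 (- (x - y) $ i))"
    if "x \<in> A J" "y \<in> B J" for J x y
  proof -
    have x: "0 \<le> x $ i" "x $ i \<noteq> 0 \<longleftrightarrow> i \<in> J" for i
      using that P(1) by (auto simp: A_def anti_blocking_def less_eq_vec_def)
    have y: "0 \<le> y $ i" "i \<in> J \<Longrightarrow> y $ i = 0" for i
      using that Q(1) by (auto simp: B_def coord_face_def anti_blocking_def less_eq_vec_def)
    have "i \<in> J \<longleftrightarrow> x $ i - y $ i > 0" for i
      using x[of i] y[of i] by (cases "i \<in> J") auto
    moreover have "x $ i = max 0 (x $ i - y $ i) \<and> y $ i = max 0 (y $ i - x $ i)" for i
      using x[of i] y[of i] by (cases "i \<in> J") auto
    ultimately show ?thesis by (auto simp: vec_eq_iff)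
  qed
  have "inj_on ?f ?D"
  proof (rule inj_onI, clarsimp)
    fix J x y J' x' y'
    assume *: "x \<in> A J" "y \<in> B J" "x' \<in> A J'" "y' \<in> B J'" and eq: "x - y = x' - y'"
    show "J = J' \<and> x = x' \<and> y = y'"
      using pos[OF *(1,2)] pos[OF *(3,4)] unfolding eq by metis
  qed
  moreover have "?f ` ?D = minkowski_diff P Q \<inter> integer_points"
  proof (intro equalityI subsetI)
    fix z assume "z \<in> ?f ` ?D"
    then show "z \<in> minkowski_diff P Q \<inter> integer_points"
      by (auto simp: A_def B_def coord_face_def minkowski_diff_def integer_points_def)
  next
    fix z assume "z \<in> minkowski_diff P Q \<inter> integer_points"
    then obtain x y where z: "z = x - y" "x \<in> P" "y \<in> Q" "\<And>i. z $ i \<in> \<int>"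
      by (auto simp: minkowski_diff_def integer_points_def)
    \<comment> \<open>The given \<open>x\<close> and \<open>y\<close> may be non-integral with
      overlapping supports. The parts of \<open>z\<close> lie below them, since \<open>x\<close> and
      \<open>y\<close> are nonnegative, and inherit integrality from \<open>z\<close>.\<close>
    define zp zm :: "real ^ 'n"
      where "zp = (\<chi> i. max 0 (z $ i))" and "zm = (\<chi> i. max 0 (- z $ i))"
    have "0 \<le> zp" "0 \<le> zm" "zp \<le> x" "zm \<le> y"
      using z P(1) Q(1) by (auto simp: zp_def zm_def less_eq_vec_def anti_blocking_def)
    then have "zp \<in> P" "zm \<in> Q" using z P(1) Q(1) by (auto simp: anti_blocking_def)
    moreover have "zp \<in> integer_points" "zm \<in> integer_points"
      using z(4) by (auto simp: zp_def zm_def integer_points_def max_def)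
    ultimately have "zp \<in> A {i. z $ i > 0}" "zm \<in> B {i. z $ i > 0}"
      by (auto simp: A_def B_def coord_face_def zp_def zm_def max_def split: if_splits)
    moreover have "z = zp - zm" by (auto simp: vec_eq_iff zp_def zm_def max_def)
    ultimately show "z \<in> ?f ` ?D" by force
  qed
  ultimately have "card (minkowski_diff P Q \<inter> integer_points) = card ?D"
    using card_image[of ?f ?D] by simp
  also have "\<dots> = (\<Sum>J\<in>UNIV. card (A J \<times> B J))"
  proof (intro card_SigmaI ballI finite_cartesian_product)
    fix J
    show "finite (A J)"
      using finite_bounded_Int_integer_points[OF P(2)]
      by (rule rev_finite_subset) (auto simp: A_def)
    show "finite (B J)" unfolding B_def
      using Q(2) by (intro finite_bounded_Int_integer_points) (auto simp: coord_face_def intro: bounded_subset)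
  qed simp
  finally show ?thesis by (simp add: A_def B_def card_cartesian_product)
qed

theorem theorem3p24:
  fixes P1 P2 :: "(real ^ 'n) set" and a b :: nat
  assumes "rational_polytope P1" and "full_dimensional P1" and "anti_blocking P1"
    and "rational_polytope P2" and "full_dimensional P2" and "anti_blocking P2"
    and "dual_integral P1"
    and "a > 0" and "b > 0"
  shows "card (minkowski_diff (dilate a P1) (dilate b P2) \<inter> integer_points) =
    (\<Sum>J\<in>Pow (UNIV :: 'n set).
       card (rel_interior (dilate (a + 1) (coord_face P1 J)) \<inter> integer_points) *
       card (dilate b (coord_face P2 (- J)) \<inter> integer_points))"
proof -
  have P: "polytope P1" "polytope P2" using assms by (auto simp: rational_polytope_def)
  show ?thesis
    \<comment> \<open>This turns the first factors into counts of points of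
      \<open>dilate a P1\<close> by support, the form produced by the count for
      \<open>dilate a P1\<close> and \<open>dilate b P2\<close>.\<close>
    unfolding rel_interior_dilate_coord_face_Int_integer_points[OF P(1) assms(2,3,7,8)]
    using assms P
    by (simp add: card_minkowski_diff_anti_blocking anti_blocking_dilate bounded_dilate
        polytope_imp_bounded coord_face_dilate)
qed

end
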